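(* Let $\mathcal{H}$ be a separable complex Hilbert space, let $C\in GL(\mathcal{H})$ be self-adjoint, and let $\Psi=(\psi_n)_{n\in\Gamma}$ be a family of vectors in $\mathcal{H}$. Then $\Psi$ is a frame controlled by $C$ if and only if $\Psi$ is a (classical) frame for $\mathcal{H}$, and $C$ is positive and commutes with the frame operator $L$ of $\Psi$.
   Context: The inner product $\langle\cdot,\cdot\rangle$ is linear in the first coordinate. $\Gamma$ is a countable index set (series are taken with respect to a fixed enumeration). $GL(\mathcal{H})$ is the set of bounded linear operators on $\mathcal{H}$ with a bounded inverse. A bounded operator $T$ is positive if $\langle Tf,f\rangle>0$ for all $f\neq 0$. A sequence $\Psi=(\psi_n)_{n\in\Gamma}$ in $\mathcal{H}$ is a (classical) frame if there are constants $m>0$, $M<\infty$ with $m\|f\|^2 \le \sum_{n} |\langle f,\psi_n\rangle|^2 \le M\|f\|^2$ for all $f\in\mathcal{H}$. Its frame operator is $L f = \sum_n \langle f,\psi_n\rangle \psi_n$. For $C\in GL(\mathcal{H})$, a family $\Psi=(\psi_n)_{n\in\Gamma}$ in $\mathcal{H}$ is a frame controlled by $C$ if there are constants $m_{CL}>0$, $M_{CL}<\infty$ such that for all $f\in\mathcal{H}$ the following series converges and $$m_{CL}\|f\|^2 \le \sum_{n} \langle \psi_n, f\rangle\langle f, C\psi_n\rangle \le M_{CL}\|f\|^2$$ (in particular the sum is real). *)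

theory Defs
  imports "HOL-Analysis.Analysis"
begin

text \<open>The inner product is linear in the first coordinate.  The norm, topology and real
  scalar multiplication inherited from \<^class>\<open>real_normed_vector\<close> are tied to the complex structure
  by \<open>cinner_eq_norm\<close> and \<open>scaleR_scaleC\<close>.\<close>

class complex_inner = real_normed_vector +
  fixes scaleC :: "complex \<Rightarrow> 'a \<Rightarrow> 'a" (infixr "*\<^sub>C" 75)
    and cinner :: "'a \<Rightarrow> 'a \<Rightarrow> complex"
  assumes scaleC_add_right: "c *\<^sub>C (x + y) = c *\<^sub>C x + c *\<^sub>C y"
    and scaleC_add_left: "(c + d) *\<^sub>C x = c *\<^sub>C x + d *\<^sub>C x"
    and scaleC_scaleC: "c *\<^sub>C (d *\<^sub>C x) = (c * d) *\<^sub>C x"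
    and scaleC_one: "1 *\<^sub>C x = x"
    and scaleR_scaleC: "r *\<^sub>R x = complex_of_real r *\<^sub>C x"
    and cinner_commute: "cinner x y = cnj (cinner y x)"
    and cinner_add_left: "cinner (x + y) z = cinner x z + cinner y z"
    and cinner_scaleC_left: "cinner (c *\<^sub>C x) y = c * cinner x y"
    and cinner_eq_norm: "cinner x x = complex_of_real ((norm x)\<^sup>2)"

class complex_hilbert = complex_inner + complete_space
begin
subclass banach ..
end

instantiation complex :: complex_hilbert
begin

definition scaleC_complex :: "complex \<Rightarrow> complex \<Rightarrow> complex"
  where "scaleC_complex c x = c * x"

definition cinner_complex :: "complex \<Rightarrow> complex \<Rightarrow> complex"
  where "cinner_complex x y = x * cnj y"

instance
proof
  fix c d x y z :: complex and r :: real
  show "cinner x x = complex_of_real ((norm x)\<^sup>2)"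
    by (simp only: cinner_complex_def complex_norm_square)
qed (simp_all add: scaleC_complex_def cinner_complex_def algebra_simps scaleR_conv_of_real)

end

definition bounded_clinear :: "('h::complex_inner \<Rightarrow> 'h) \<Rightarrow> bool"
  where "bounded_clinear T \<longleftrightarrow> bounded_linear T \<and> (\<forall>c x. T (c *\<^sub>C x) = c *\<^sub>C T x)"

definition GL :: "('h::complex_inner \<Rightarrow> 'h) set"
  where "GL = {T. bounded_clinear T \<and>
                  (\<exists>S. bounded_clinear S \<and> S \<circ> T = id \<and> T \<circ> S = id)}"

definition self_adjoint :: "('h::complex_inner \<Rightarrow> 'h) \<Rightarrow> bool"
  where "self_adjoint T \<longleftrightarrow> (\<forall>f g. cinner (T f) g = cinner f (T g))"

text \<open>Positivity is strict, and includes that the quadratic form is real-valued.\<close>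

definition positive_op :: "('h::complex_inner \<Rightarrow> 'h) \<Rightarrow> bool"
  where "positive_op T \<longleftrightarrow>
    (\<forall>f. f \<noteq> 0 \<longrightarrow> cinner (T f) f \<in> \<real> \<and> 0 < Re (cinner (T f) f))"

text \<open>The index set may be finite or infinite; accordingly it is enumerated by an initial segment
  of the natural numbers or by all of them.  In the finite case the sequence of terms is padded
  with zeros, so that the library's \<^const>\<open>sums\<close>, \<^const>\<open>summable\<close> and \<^const>\<open>suminf\<close> apply in both cases.\<close>

definition enum_dom :: "'i set \<Rightarrow> nat set"
  where "enum_dom \<Gamma> = (if finite \<Gamma> then {..<card \<Gamma>} else UNIV)"

definition enumeration :: "'i set \<Rightarrow> (nat \<Rightarrow> 'i) \<Rightarrow> bool"
  where "enumeration \<Gamma> e \<longleftrightarrow> bij_betw e (enum_dom \<Gamma>) \<Gamma>"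

definition enum_terms :: "'i set \<Rightarrow> (nat \<Rightarrow> 'i) \<Rightarrow> ('i \<Rightarrow> 'b::zero) \<Rightarrow> nat \<Rightarrow> 'b"
  where "enum_terms \<Gamma> e a k = (if k \<in> enum_dom \<Gamma> then a (e k) else 0)"

lemma enum_terms_sums_finite:
  fixes a :: "'i \<Rightarrow> 'b::real_normed_vector"
  assumes "enumeration \<Gamma> e" "finite \<Gamma>"
  shows "enum_terms \<Gamma> e a sums (\<Sum>n\<in>\<Gamma>. a n)"
proof -
  have "enum_terms \<Gamma> e a sums (\<Sum>k\<in>enum_dom \<Gamma>. enum_terms \<Gamma> e a k)"
    by (rule sums_finite) (auto simp: enum_dom_def enum_terms_def assms(2))
  also have "(\<Sum>k\<in>enum_dom \<Gamma>. enum_terms \<Gamma> e a k) = (\<Sum>k\<in>enum_dom \<Gamma>. a (e k))"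
    by (simp add: enum_terms_def)
  also have "\<dots> = (\<Sum>n\<in>\<Gamma>. a n)"
    using assms(1) unfolding enumeration_def by (rule sum.reindex_bij_betw)
  finally show ?thesis .
qed

definition is_frame :: "'i set \<Rightarrow> (nat \<Rightarrow> 'i) \<Rightarrow> ('i \<Rightarrow> 'h::complex_inner) \<Rightarrow> bool"
  where "is_frame \<Gamma> e \<psi> \<longleftrightarrow>
    (\<exists>m M::real. m > 0 \<and>
      (\<forall>f. summable (enum_terms \<Gamma> e (\<lambda>n. (cmod (cinner f (\<psi> n)))\<^sup>2)) \<and>
           m * (norm f)\<^sup>2 \<le> suminf (enum_terms \<Gamma> e (\<lambda>n. (cmod (cinner f (\<psi> n)))\<^sup>2)) \<and>
           suminf (enum_terms \<Gamma> e (\<lambda>n. (cmod (cinner f (\<psi> n)))\<^sup>2)) \<le> M * (norm f)\<^sup>2))"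

text \<open>Norm-convergent whenever \<open>\<psi>\<close> is a frame, and only meaningful in that case.\<close>

definition frame_operator ::
    "'i set \<Rightarrow> (nat \<Rightarrow> 'i) \<Rightarrow> ('i \<Rightarrow> 'h::complex_inner) \<Rightarrow> 'h \<Rightarrow> 'h"
  where "frame_operator \<Gamma> e \<psi> f = suminf (enum_terms \<Gamma> e (\<lambda>n. cinner f (\<psi> n) *\<^sub>C \<psi> n))"

definition controlled_frame ::
    "('h::complex_inner \<Rightarrow> 'h) \<Rightarrow> 'i set \<Rightarrow> (nat \<Rightarrow> 'i) \<Rightarrow> ('i \<Rightarrow> 'h) \<Rightarrow> bool"
  where "controlled_frame C \<Gamma> e \<psi> \<longleftrightarrow>
    (\<exists>m M::real. m > 0 \<and>
      (\<forall>f. \<exists>s::real.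
           enum_terms \<Gamma> e (\<lambda>n. cinner (\<psi> n) f * cinner f (C (\<psi> n))) sums complex_of_real s \<and>
           m * (norm f)\<^sup>2 \<le> s \<and> s \<le> M * (norm f)\<^sup>2))"

end

theory Submission
  imports Defs
begin

text \<open>Let \<open>L\<close> be the frame operator.  Since \<open>C\<close> is self-adjoint, the controlled quadratic form is
  \<open>\<Sum>n. \<langle>C f, \<psi>\<^sub>n\<rangle> \<langle>\<psi>\<^sub>n, f\<rangle> = \<langle>L C f, f\<rangle>\<close>, so the theorem compares bounds for \<open>L C\<close> with bounds for \<open>L\<close>.

  Suppose that \<open>\<Psi>\<close> is controlled by \<open>C\<close>.  The controlled series may converge only conditionally, so the
  existence of \<open>L\<close> has to be established first.  Polarization and surjectivity of \<open>C\<close> turn the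
  assumption into convergence and boundedness of \<open>\<Sum>n. \<bar>\<langle>g, \<psi>\<^sub>n\<rangle>\<bar>\<^sup>2\<close> (\<open>bessel_bound_if_controlled\<close>).  Then
  \<open>L\<close> is a bounded positive operator, and \<open>L C\<close> has a real quadratic form, hence is self-adjoint, which
  says that \<open>L\<close> and \<open>C\<close> commute.  As \<open>L C\<close> is bounded below by a positive constant, so is \<open>L\<close> in norm; for
  a positive operator this bounds the quadratic form below (\<open>positive_semidefinite_coercive\<close>) and
  gives the lower frame bound.  Positivity of \<open>C\<close> follows from \<open>\<langle>C L f, L f\<rangle> = \<langle>L (L C) f, f\<rangle> \<ge> 0\<close>
  and density of the range of \<open>L\<close> (\<open>positive_semidefinite_factor\<close>).

  Conversely, if \<open>L \<ge> m > 0\<close>, \<open>C \<ge> b > 0\<close>, and they commute, then \<open>(L - m) C \<ge> 0\<close>, so \<open>L C \<ge> m C \<ge> m b\<close>.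

  Both directions rest on the fact that a product of commuting positive operators is positive
  (\<open>positive_semidefinite_commuting_product\<close>).\<close>

section \<open>Complex inner products\<close>

lemma cinner_add_right: "cinner (x::'h::complex_inner) (y + z) = cinner x y + cinner x z"
  by (metis cinner_add_left cinner_commute complex_cnj_add)

lemma cinner_scaleC_right: "cinner (x::'h::complex_inner) (c *\<^sub>C y) = cnj c * cinner x y"
  by (metis cinner_commute cinner_scaleC_left complex_cnj_mult)

lemma cinner_scaleR_left: "cinner (r *\<^sub>R x::'h::complex_inner) y = complex_of_real r * cinner x y"
  by (simp add: scaleR_scaleC cinner_scaleC_left)

lemma cinner_scaleR_right: "cinner (x::'h::complex_inner) (r *\<^sub>R y) = complex_of_real r * cinner x y"
  by (simp add: scaleR_scaleC cinner_scaleC_right)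

lemma cinner_zero_left [simp]: "cinner (0::'h::complex_inner) y = 0"
  using cinner_scaleR_left[of 0 0 y] by simp

lemma cinner_zero_right [simp]: "cinner (x::'h::complex_inner) 0 = 0"
  using cinner_scaleR_right[of x 0 0] by simp

lemma cinner_minus_left: "cinner (- x::'h::complex_inner) y = - cinner x y"
  using cinner_scaleR_left[of "-1" x y] by simp

lemma cinner_minus_right: "cinner (x::'h::complex_inner) (- y) = - cinner x y"
  using cinner_scaleR_right[of x "-1" y] by simp

lemma cinner_diff_left: "cinner (x - y::'h::complex_inner) z = cinner x z - cinner y z"
  using cinner_add_left[of x "- y" z] by (simp add: cinner_minus_left)

lemma cinner_diff_right: "cinner (x::'h::complex_inner) (y - z) = cinner x y - cinner x z"
  using cinner_add_right[of x y "- z"] by (simp add: cinner_minus_right)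

lemma scaleC_zero_right [simp]: "c *\<^sub>C (0::'h::complex_inner) = 0"
  using scaleC_add_right[of c "0::'h" 0] by simp

lemmas cinner_simps =
  cinner_add_left cinner_add_right cinner_diff_left cinner_diff_right
  cinner_scaleR_left cinner_scaleR_right cinner_scaleC_left cinner_scaleC_right

lemma Re_cinner_self [simp]: "Re (cinner x (x::'h::complex_inner)) = (norm x)\<^sup>2"
  by (simp add: cinner_eq_norm)

lemma Re_cinner_commute: "Re (cinner x (y::'h::complex_inner)) = Re (cinner y x)"
  by (subst cinner_commute) simp

lemma cmod_cinner_commute: "cmod (cinner x (y::'h::complex_inner)) = cmod (cinner y x)"
  by (subst cinner_commute) simp

lemma norm_scaleC: "norm (c *\<^sub>C (x::'h::complex_inner)) = cmod c * norm x"
proof -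
  have "complex_of_real ((norm (c *\<^sub>C x))\<^sup>2) = (c * cnj c) * cinner x x"
    by (simp only: cinner_eq_norm[symmetric] cinner_scaleC_left cinner_scaleC_right mult_ac)
  also have "\<dots> = complex_of_real ((cmod c * norm x)\<^sup>2)"
    by (simp add: cinner_eq_norm complex_norm_square[symmetric] power_mult_distrib)
  finally have "(norm (c *\<^sub>C x))\<^sup>2 = (cmod c * norm x)\<^sup>2"
    using of_real_eq_iff by blast
  then show ?thesis by simp
qed

lemma Re_cinner_le_norm: "Re (cinner x (y::'h::complex_inner)) \<le> norm x * norm y"
proof -
  have "(norm (x + y))\<^sup>2 = (norm x)\<^sup>2 + (norm y)\<^sup>2 + 2 * Re (cinner x y)"
    by (simp add: Re_cinner_self[symmetric] cinner_simps Re_cinner_commute[of y x]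
        del: Re_cinner_self)
  moreover have "(norm (x + y))\<^sup>2 \<le> (norm x + norm y)\<^sup>2"
    by (simp add: norm_triangle_ineq power_mono)
  ultimately show ?thesis by (simp add: power2_sum)
qed

text \<open>Rotating \<open>x\<close> by a unimodular scalar makes the inner product real and nonnegative, which
  reduces Cauchy--Schwarz to the triangle inequality for the norm.\<close>

lemma cinner_Cauchy_Schwarz: "cmod (cinner x (y::'h::complex_inner)) \<le> norm x * norm y"
proof -
  define c where "c = cnj (sgn (cinner x y))"
  have "c * cinner x y = complex_of_real (cmod (cinner x y))"
    by (cases "cinner x y = 0")
      (auto simp: c_def sgn_eq field_simps complex_norm_square[symmetric] power2_eq_square
        simp flip: of_real_mult)
  then have "cmod (cinner x y) = Re (cinner (c *\<^sub>C x) y)"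
    by (simp add: cinner_scaleC_left)
  also have "\<dots> \<le> cmod c * norm x * norm y"
    using Re_cinner_le_norm[of "c *\<^sub>C x" y] by (simp add: norm_scaleC)
  also have "\<dots> \<le> 1 * norm x * norm y"
    by (intro mult_right_mono) (auto simp: c_def norm_sgn)
  finally show ?thesis by simp
qed

lemma bounded_bilinear_cinner: "bounded_bilinear (\<lambda>x y::'h::complex_inner. cinner x y)"
proof
  show "\<exists>K. \<forall>x y::'h. norm (cinner x y) \<le> norm x * norm y * K"
    using cinner_Cauchy_Schwarz by (intro exI[of _ 1]) auto
qed (simp_all add: cinner_simps scaleR_conv_of_real)

lemmas bounded_linear_cinner_left = bounded_bilinear.bounded_linear_left[OF bounded_bilinear_cinner]

section \<open>Positive self-adjoint operators\<close>

text \<open>The form may vanish or be non-real, unlike in \<open>positive_op\<close>; for a self-adjoint operator it is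
  automatically real.\<close>

definition positive_semidefinite :: "('h::complex_inner \<Rightarrow> 'h) \<Rightarrow> bool"
  where "positive_semidefinite T \<longleftrightarrow> (\<forall>f. 0 \<le> Re (cinner (T f) f))"

lemma bounded_linear_quadratic_form_bound:
  fixes T :: "'h::complex_inner \<Rightarrow> 'h"
  assumes "bounded_linear T"
  obtains K where "0 < K" "\<And>f. norm (T f) \<le> K * norm f" "\<And>f. Re (cinner (T f) f) \<le> K * (norm f)\<^sup>2"
proof -
  obtain K where K: "0 < K" "\<And>f. norm (T f) \<le> norm f * K"
    using bounded_linear.pos_bounded[OF assms] by auto
  have "Re (cinner (T f) f) \<le> K * (norm f)\<^sup>2" for f
  proof -
    have "Re (cinner (T f) f) \<le> norm (T f) * norm f" by (rule Re_cinner_le_norm)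
    also have "\<dots> \<le> (norm f * K) * norm f" by (intro mult_right_mono K(2)) simp
    finally show ?thesis by (simp add: power2_eq_square algebra_simps)
  qed
  with K show ?thesis by (intro that[of K]) (auto simp: mult.commute)
qed

text \<open>Expand \<open>0 \<le> \<langle>T h, h\<rangle>\<close> at \<open>h = f - T f / K\<close> and bound the term that is quadratic in \<open>T f\<close> by \<open>K\<close>.\<close>

lemma positive_semidefinite_norm_square_le:
  fixes T :: "'h::complex_inner \<Rightarrow> 'h"
  assumes lin: "bounded_linear T" and sa: "self_adjoint T" and pos: "positive_semidefinite T"
    and K: "0 < K" "\<And>f. Re (cinner (T f) f) \<le> K * (norm f)\<^sup>2"
  shows "(norm (T f))\<^sup>2 \<le> K * Re (cinner (T f) f)"
proof -
  interpret bounded_linear T by (rule lin)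
  have cross: "cinner (T (T f)) f = cinner (T f) (T f)"
    using sa by (simp add: self_adjoint_def)
  define t where "t = 1 / K"
  have "0 \<le> Re (cinner (T (f - t *\<^sub>R T f)) (f - t *\<^sub>R T f))"
    using pos by (simp only: positive_semidefinite_def)
  also have "\<dots> = Re (cinner (T f) f) - 2 * t * (norm (T f))\<^sup>2
      + t\<^sup>2 * Re (cinner (T (T f)) (T f))"
    by (simp add: diff scale cinner_simps cross algebra_simps power2_eq_square[of t])
  also have "\<dots> \<le> Re (cinner (T f) f) - 2 * t * (norm (T f))\<^sup>2 + t\<^sup>2 * (K * (norm (T f))\<^sup>2)"
    by (intro add_left_mono mult_left_mono K(2)) simp
  also have "\<dots> = Re (cinner (T f) f) - (norm (T f))\<^sup>2 / K"
    using K(1) by (simp add: t_def field_simps power2_eq_square)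
  finally show ?thesis using K(1) by (simp add: field_simps)
qed

text \<open>For a positive operator, being bounded below in norm already bounds the quadratic form
  below, because \<open>\<langle>T f, f\<rangle>\<close> dominates a multiple of \<open>\<parallel>T f\<parallel>\<^sup>2\<close>.\<close>

lemma positive_semidefinite_coercive:
  fixes T :: "'h::complex_inner \<Rightarrow> 'h"
  assumes lin: "bounded_linear T" and sa: "self_adjoint T" and pos: "positive_semidefinite T"
    and a: "0 < a" "\<And>f. a * norm f \<le> norm (T f)"
  obtains c where "0 < c" "\<And>f. c * (norm f)\<^sup>2 \<le> Re (cinner (T f) f)"
proof -
  obtain K where K: "0 < K" "\<And>f. Re (cinner (T f) f) \<le> K * (norm f)\<^sup>2"
    using bounded_linear_quadratic_form_bound[OF lin] by metis
  have "a\<^sup>2 / K * (norm f)\<^sup>2 \<le> Re (cinner (T f) f)" for f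
  proof -
    have "(a * norm f)\<^sup>2 \<le> (norm (T f))\<^sup>2"
      using a by (intro power_mono) auto
    also have "\<dots> \<le> K * Re (cinner (T f) f)"
      by (rule positive_semidefinite_norm_square_le[OF lin sa pos K])
    finally show ?thesis using K(1) by (simp add: field_simps power_mult_distrib)
  qed
  then show ?thesis using a(1) K(1) by (intro that[of "a\<^sup>2 / K"]) auto
qed

text \<open>Riesz's argument.  After scaling to \<open>0 \<le> A \<le> 1\<close>, the recursion \<open>R\<^sub>0 = A\<close>,
  \<open>R\<^sub>n\<^sub>+\<^sub>1 = R\<^sub>n - R\<^sub>n\<^sup>2\<close> stays between \<open>0\<close> and \<open>1\<close> and telescopes to \<open>A = \<Sum>n. R\<^sub>n\<^sup>2\<close> in the strong
  sense.  Each \<open>R\<^sub>n\<close> commutes with \<open>B\<close>, so \<open>\<langle>B A f, f\<rangle> = \<Sum>n. \<langle>B R\<^sub>n f, R\<^sub>n f\<rangle> \<ge> 0\<close>.  The sum of squares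
  plays the part of the square root of \<open>A\<close>.\<close>

lemma positive_semidefinite_commuting_product:
  fixes A B :: "'h::complex_inner \<Rightarrow> 'h"
  assumes linA: "bounded_linear A" and saA: "self_adjoint A" and posA: "positive_semidefinite A"
    and linB: "bounded_linear B" and posB: "positive_semidefinite B"
    and comm: "\<And>f. A (B f) = B (A f)"
  shows "positive_semidefinite (\<lambda>f. B (A f))"
proof -
  interpret B: bounded_linear B by (rule linB)
  obtain K where K: "0 < K" "\<And>f. Re (cinner (A f) f) \<le> K * (norm f)\<^sup>2"
    using bounded_linear_quadratic_form_bound[OF linA] by metis
  define R where "R = rec_nat (\<lambda>f. (1 / K) *\<^sub>R A f) (\<lambda>_ T f. T f - T (T f))"
  have R0: "R 0 = (\<lambda>f. (1 / K) *\<^sub>R A f)" and RS: "\<And>n. R (Suc n) = (\<lambda>f. R n f - R n (R n f))"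
    by (simp_all add: R_def)
  have inv: "bounded_linear (R n) \<and> self_adjoint (R n) \<and> positive_semidefinite (R n) \<and>
      (\<forall>f. Re (cinner (R n f) f) \<le> 1 * (norm f)\<^sup>2) \<and> (\<forall>f. R n (B f) = B (R n f))" for n
  proof (induction n)
    case 0
    show ?case
      using linA saA posA K
      by (auto simp: R0 self_adjoint_def positive_semidefinite_def cinner_simps comm B.scale
          field_simps intro: bounded_linear_scaleR_right[THEN bounded_linear_compose])
  next
    case (Suc n)
    then have lin: "bounded_linear (R n)" and sa: "self_adjoint (R n)"
      and pos: "positive_semidefinite (R n)"
      and le: "\<And>f. Re (cinner (R n f) f) \<le> 1 * (norm f)\<^sup>2"
      and com: "\<And>f. R n (B f) = B (R n f)" by blast+
    have sq: "cinner (R n (R n f)) f = cinner (R n f) (R n f)" for f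
      using sa by (simp add: self_adjoint_def)
    have "bounded_linear (R (Suc n))"
      unfolding RS by (intro bounded_linear_sub lin bounded_linear_compose[OF lin lin])
    moreover have "self_adjoint (R (Suc n))"
      using sa by (auto simp: RS self_adjoint_def cinner_simps)
    \<comment> \<open>This is \<open>\<parallel>R\<^sub>n f\<parallel>\<^sup>2 \<le> \<langle>R\<^sub>n f, f\<rangle>\<close>, which holds because \<open>R\<^sub>n \<le> 1\<close>.\<close>
    moreover have "positive_semidefinite (R (Suc n))"
      using positive_semidefinite_norm_square_le[OF lin sa pos zero_less_one le]
      by (simp add: positive_semidefinite_def RS cinner_simps sq)
    moreover have "Re (cinner (R (Suc n) f) f) \<le> 1 * (norm f)\<^sup>2" for f
      using le[of f] by (simp add: RS cinner_simps sq) (smt (verit) zero_le_power2)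
    moreover have "R (Suc n) (B f) = B (R (Suc n) f)" for f
      by (simp add: RS com B.diff)
    ultimately show ?case by blast
  qed
  have sq: "cinner (R n (R n f)) g = cinner (R n f) (R n g)" for n f g
    using inv[of n] by (simp add: self_adjoint_def)
  have com: "B (R n f) = R n (B f)" for n f
    using inv[of n] by simp
  have "0 \<le> Re (cinner (B (A f)) f)" for f
  proof -
    have part: "(\<Sum>k<n. (norm (R k f))\<^sup>2) = Re (cinner (R 0 f) f) - Re (cinner (R n f) f)" for n
      by (induction n) (auto simp: RS cinner_simps sq)
    \<comment> \<open>The sum of squares is bounded, so its terms and with them the remainder tend to zero.\<close>
    have "(\<Sum>k<n. (norm (R k f))\<^sup>2) \<le> Re (cinner (R 0 f) f)" for n
      using inv[of n] by (simp add: part positive_semidefinite_def)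
    then have "summable (\<lambda>k. (norm (R k f))\<^sup>2)"
      by (intro bounded_imp_summable[where B = "Re (cinner (R 0 f) f)"])
        (auto simp only: lessThan_Suc_atMost[symmetric] zero_le_power2)
    then have "(\<lambda>k. sqrt ((norm (R k f))\<^sup>2)) \<longlonglongrightarrow> sqrt 0"
      by (intro tendsto_real_sqrt summable_LIMSEQ_zero)
    then have "(\<lambda>k. R k f) \<longlonglongrightarrow> 0"
      by (simp add: tendsto_norm_zero_iff)
    then have "(\<lambda>k. Re (cinner (B (R k f)) f)) \<longlonglongrightarrow> Re (cinner (B 0) f)"
      by (intro tendsto_Re bounded_linear.tendsto[OF bounded_linear_cinner_left] B.tendsto)
    then have lim: "(\<lambda>k. Re (cinner (B (R k f)) f)) \<longlonglongrightarrow> 0"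
      by (simp add: B.zero)
    have "Re (cinner (B (R n f)) f) \<le> Re (cinner (B (R 0 f)) f)" for n
    proof (induction n)
      case (Suc n)
      have "cinner (B (R n (R n f))) f = cinner (B (R n f)) (R n f)"
        by (simp add: com sq)
      moreover have "0 \<le> Re (cinner (B (R n f)) (R n f))"
        using posB by (simp only: positive_semidefinite_def)
      ultimately have "Re (cinner (B (R (Suc n) f)) f) \<le> Re (cinner (B (R n f)) f)"
        by (simp add: RS B.diff cinner_simps)
      then show ?case using Suc by simp
    qed simp
    then have "0 \<le> Re (cinner (B (R 0 f)) f)"
      by (intro LIMSEQ_le_const2[OF lim]) auto
    then show ?thesis
      using K(1) by (simp add: R0 B.scale cinner_simps zero_le_divide_iff)
  qed
  then show ?thesis by (simp add: positive_semidefinite_def)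
qed

text \<open>Gradient descent with step \<open>1 / K\<close>, \<open>T \<le> K\<close>, for the equation \<open>T g = f\<close>: the residual \<open>f - T g\<close> is multiplied by
  \<open>1 - T / K\<close> in each step, which contracts by the factor \<open>sqrt (1 - c / K)\<close>.\<close>

lemma coercive_dense_range:
  fixes T :: "'h::complex_inner \<Rightarrow> 'h"
  assumes lin: "bounded_linear T" and sa: "self_adjoint T"
    and c: "0 < c" "\<And>f. c * (norm f)\<^sup>2 \<le> Re (cinner (T f) f)"
  obtains g where "(\<lambda>n. T (g n)) \<longlonglongrightarrow> f"
proof -
  interpret bounded_linear T by (rule lin)
  obtain K0 where K0: "0 < K0" "\<And>f. Re (cinner (T f) f) \<le> K0 * (norm f)\<^sup>2"
    using bounded_linear_quadratic_form_bound[OF lin] by metis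
  \<comment> \<open>On the zero space any \<open>c\<close> is admissible; adding it keeps \<open>1 - c / K\<close> nonnegative there, too.\<close>
  define K where "K = K0 + c"
  have K: "0 < K" "c < K" "Re (cinner (T f) f) \<le> K * (norm f)\<^sup>2" for f
    using K0(1) c(1) K0(2)[of f] by (auto simp: K_def distrib_right intro: add_increasing2)
  have pos: "positive_semidefinite T"
    unfolding positive_semidefinite_def using c
    by (meson order_trans less_imp_le mult_nonneg_nonneg zero_le_power2)
  define q where "q = 1 - c / K"
  have q: "0 \<le> q" "q < 1" using K c(1) by (auto simp: q_def field_simps)
  have contract: "(norm (f - (1 / K) *\<^sub>R T f))\<^sup>2 \<le> q * (norm f)\<^sup>2" for f
  proof -
    have "(norm (f - (1 / K) *\<^sub>R T f))\<^sup>2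
        = (norm f)\<^sup>2 - 2 / K * Re (cinner (T f) f) + (norm (T f))\<^sup>2 / K\<^sup>2"
      unfolding Re_cinner_self[symmetric]
      by (simp add: cinner_simps Re_cinner_commute[of f "T f"] power2_eq_square[of K]
          diff_divide_distrib del: Re_cinner_self)
    also have "\<dots> \<le> (norm f)\<^sup>2 - 2 / K * Re (cinner (T f) f) + K * Re (cinner (T f) f) / K\<^sup>2"
      by (intro add_left_mono divide_right_mono
          positive_semidefinite_norm_square_le[OF lin sa pos K(1) K(3)]) simp
    also have "\<dots> = (norm f)\<^sup>2 - Re (cinner (T f) f) / K"
      using K(1) by (simp add: field_simps power2_eq_square)
    also have "\<dots> \<le> (norm f)\<^sup>2 - c * (norm f)\<^sup>2 / K"
      by (intro diff_left_mono divide_right_mono c(2)) (use K(1) in simp)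
    finally show ?thesis by (simp add: q_def algebra_simps)
  qed
  define g where "g = rec_nat 0 (\<lambda>_ g. g + (1 / K) *\<^sub>R (f - T g))"
  have g: "g 0 = 0" "\<And>n. g (Suc n) = g n + (1 / K) *\<^sub>R (f - T (g n))"
    by (simp_all add: g_def)
  have bound: "(norm (f - T (g n)))\<^sup>2 \<le> q ^ n * (norm f)\<^sup>2" for n
  proof (induction n)
    case (Suc n)
    have "f - T (g (Suc n)) = (f - T (g n)) - (1 / K) *\<^sub>R T (f - T (g n))"
      by (simp only: g add scale) simp
    with contract[of "f - T (g n)"] have "(norm (f - T (g (Suc n))))\<^sup>2 \<le> q * (norm (f - T (g n)))\<^sup>2"
      by (simp only:)
    also have "\<dots> \<le> q * (q ^ n * (norm f)\<^sup>2)"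
      by (intro mult_left_mono Suc q)
    finally show ?case by simp
  qed (simp add: g zero)
  have "(\<lambda>n. q ^ n * (norm f)\<^sup>2) \<longlonglongrightarrow> 0"
    using q by (intro tendsto_mult_left_zero LIMSEQ_power_zero) auto
  then have "(\<lambda>n. (norm (f - T (g n)))\<^sup>2) \<longlonglongrightarrow> 0"
    by (rule tendsto_sandwich[rotated 3]) (use bound in auto)
  then have "(\<lambda>n. sqrt ((norm (f - T (g n)))\<^sup>2)) \<longlonglongrightarrow> sqrt 0"
    by (rule tendsto_real_sqrt)
  then have "(\<lambda>n. f - T (g n)) \<longlonglongrightarrow> 0"
    by (simp add: tendsto_norm_zero_iff)
  then have "(\<lambda>n. f - (f - T (g n))) \<longlonglongrightarrow> f - 0"
    by (intro tendsto_diff tendsto_const)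
  then show ?thesis by (intro that[of g]) simp
qed

text \<open>A real quadratic form determines a Hermitian sesquilinear form; the imaginary parts of the
  form at \<open>f + g\<close> and at \<open>f + \<i> g\<close> give the imaginary and the real part of the claim.\<close>

lemma self_adjoint_if_real_quadratic_form:
  fixes T :: "'h::complex_inner \<Rightarrow> 'h"
  assumes lin: "bounded_clinear T" and real: "\<And>f. Im (cinner (T f) f) = 0"
  shows "self_adjoint T"
  unfolding self_adjoint_def
proof (intro allI)
  fix f g
  interpret bounded_linear T using lin by (simp add: bounded_clinear_def)
  have sc: "T (c *\<^sub>C x) = c *\<^sub>C T x" for c x
    using lin by (simp add: bounded_clinear_def)
  have "Im (cinner (T f) g) + Im (cinner (T g) f) = 0"
    using real[of "f + g"] real[of f] real[of g] by (simp add: add cinner_simps)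
  moreover have "Re (cinner (T g) f) - Re (cinner (T f) g) = 0"
    using real[of "f + \<i> *\<^sub>C g"] real[of f] real[of g] by (simp add: add sc cinner_simps)
  ultimately have "cinner (T f) g = cnj (cinner (T g) f)"
    by (simp add: complex_eq_iff)
  then show "cinner (T f) g = cinner f (T g)"
    by (simp add: cinner_commute[of f "T g"])
qed

section \<open>Bessel sequences and their frame operators\<close>

definition bessel_bound :: "real \<Rightarrow> (nat \<Rightarrow> 'h::complex_inner) \<Rightarrow> bool"
  where "bessel_bound B \<phi> \<longleftrightarrow> 0 < B \<and>
    (\<forall>f. summable (\<lambda>k. (cmod (cinner f (\<phi> k)))\<^sup>2) \<and>
         (\<Sum>k. (cmod (cinner f (\<phi> k)))\<^sup>2) \<le> B * (norm f)\<^sup>2)"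

lemma bessel_bound_sum_le:
  fixes \<phi> :: "nat \<Rightarrow> 'h::complex_inner"
  assumes "bessel_bound B \<phi>" "finite F"
  shows "(\<Sum>k\<in>F. (cmod (cinner f (\<phi> k)))\<^sup>2) \<le> B * (norm f)\<^sup>2"
proof -
  have "(\<Sum>k\<in>F. (cmod (cinner f (\<phi> k)))\<^sup>2) \<le> (\<Sum>k. (cmod (cinner f (\<phi> k)))\<^sup>2)"
    using assms by (intro sum_le_suminf) (auto simp: bessel_bound_def)
  also have "\<dots> \<le> B * (norm f)\<^sup>2"
    using assms by (simp add: bessel_bound_def)
  finally show ?thesis .
qed

text \<open>Duality: with \<open>v\<close> the sum on the left, \<open>\<parallel>v\<parallel>\<^sup>2 = \<Sum>k\<in>F. \<langle>f, \<phi>\<^sub>k\<rangle> \<langle>\<phi>\<^sub>k, v\<rangle>\<close>, and by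
  \<open>2 x y \<le> B x\<^sup>2 + y\<^sup>2 / B\<close> the factors containing \<open>v\<close> contribute at most \<open>\<parallel>v\<parallel>\<^sup>2\<close> to twice this sum.\<close>

lemma bessel_synthesis_norm_le:
  fixes \<phi> :: "nat \<Rightarrow> 'h::complex_inner"
  assumes bb: "bessel_bound B \<phi>" and fin: "finite F"
  shows "(norm (\<Sum>k\<in>F. cinner f (\<phi> k) *\<^sub>C \<phi> k))\<^sup>2 \<le> B * (\<Sum>k\<in>F. (cmod (cinner f (\<phi> k)))\<^sup>2)"
proof -
  define v where "v = (\<Sum>k\<in>F. cinner f (\<phi> k) *\<^sub>C \<phi> k)"
  have B: "0 < B" using bb by (simp add: bessel_bound_def)
  have "cinner v v = (\<Sum>k\<in>F. cinner (cinner f (\<phi> k) *\<^sub>C \<phi> k) v)"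
    unfolding v_def
    by (rule linear_sum[OF bounded_linear.linear[OF bounded_linear_cinner_left]])
  then have "2 * (norm v)\<^sup>2 = (\<Sum>k\<in>F. 2 * Re (cinner f (\<phi> k) * cinner (\<phi> k) v))"
    by (simp add: Re_cinner_self[symmetric] cinner_scaleC_left sum_distrib_left
        del: Re_cinner_self times_complex.sel)
  also have "\<dots> \<le> (\<Sum>k\<in>F. B * (cmod (cinner f (\<phi> k)))\<^sup>2 + (cmod (cinner v (\<phi> k)))\<^sup>2 / B)"
  proof (rule sum_mono)
    fix k
    define x y where "x = cmod (cinner f (\<phi> k))" and "y = cmod (cinner v (\<phi> k))"
    have "Re (cinner f (\<phi> k) * cinner (\<phi> k) v) \<le> x * y"
      using complex_Re_le_cmod[of "cinner f (\<phi> k) * cinner (\<phi> k) v"]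
      by (simp only: norm_mult cmod_cinner_commute[of "\<phi> k" v] x_def y_def)
    moreover have "0 \<le> (B * x - y)\<^sup>2 / B"
      using B by simp
    then have "2 * (x * y) \<le> B * x\<^sup>2 + y\<^sup>2 / B"
      using B by (simp add: power2_diff field_simps power2_eq_square)
    ultimately show "2 * Re (cinner f (\<phi> k) * cinner (\<phi> k) v)
        \<le> B * (cmod (cinner f (\<phi> k)))\<^sup>2 + (cmod (cinner v (\<phi> k)))\<^sup>2 / B"
      unfolding x_def y_def by linarith
  qed
  also have "\<dots> = B * (\<Sum>k\<in>F. (cmod (cinner f (\<phi> k)))\<^sup>2)
      + (\<Sum>k\<in>F. (cmod (cinner v (\<phi> k)))\<^sup>2) / B"
    by (simp add: sum.distrib sum_distrib_left sum_divide_distrib)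
  also have "\<dots> \<le> B * (\<Sum>k\<in>F. (cmod (cinner f (\<phi> k)))\<^sup>2) + (norm v)\<^sup>2"
    using bessel_bound_sum_le[OF bb fin, of v] B by (simp add: field_simps)
  finally show ?thesis by (simp add: v_def)
qed

definition bessel_operator :: "(nat \<Rightarrow> 'h::complex_inner) \<Rightarrow> 'h \<Rightarrow> 'h"
  where "bessel_operator \<phi> f = (\<Sum>k. cinner f (\<phi> k) *\<^sub>C \<phi> k)"

lemma bessel_operator_sums:
  fixes \<phi> :: "nat \<Rightarrow> 'h::complex_hilbert"
  assumes bb: "bessel_bound B \<phi>"
  shows "(\<lambda>k. cinner f (\<phi> k) *\<^sub>C \<phi> k) sums bessel_operator \<phi> f"
  unfolding bessel_operator_def
proof (rule summable_sums, subst summable_Cauchy, intro allI impI)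
  fix r :: real assume r: "0 < r"
  have B: "0 < B" and summ: "summable (\<lambda>k. (cmod (cinner f (\<phi> k)))\<^sup>2)"
    using bb by (auto simp: bessel_bound_def)
  obtain N where N: "\<And>m n. N \<le> m \<Longrightarrow> norm (\<Sum>k\<in>{m..<n}. (cmod (cinner f (\<phi> k)))\<^sup>2) < r\<^sup>2 / B"
    using summ r B unfolding summable_Cauchy by (metis divide_pos_pos zero_less_power)
  show "\<exists>N. \<forall>m\<ge>N. \<forall>n. norm (\<Sum>k\<in>{m..<n}. cinner f (\<phi> k) *\<^sub>C \<phi> k) < r"
  proof (intro exI allI impI)
    fix m n assume "N \<le> m"
    then have "(\<Sum>k\<in>{m..<n}. (cmod (cinner f (\<phi> k)))\<^sup>2) < r\<^sup>2 / B"
      using N[of m n] by (simp add: sum_nonneg)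
    then have "B * (\<Sum>k\<in>{m..<n}. (cmod (cinner f (\<phi> k)))\<^sup>2) < r\<^sup>2"
      using B by (simp add: field_simps)
    then have "(norm (\<Sum>k\<in>{m..<n}. cinner f (\<phi> k) *\<^sub>C \<phi> k))\<^sup>2 < r\<^sup>2"
      by (rule order.strict_trans1[OF bessel_synthesis_norm_le[OF bb finite_atLeastLessThan]])
    then show "norm (\<Sum>k\<in>{m..<n}. cinner f (\<phi> k) *\<^sub>C \<phi> k) < r"
      using r by (simp add: power_less_imp_less_base)
  qed
qed

lemma cinner_bessel_operator_sums:
  fixes \<phi> :: "nat \<Rightarrow> 'h::complex_hilbert"
  assumes "bessel_bound B \<phi>"
  shows "(\<lambda>k. cinner f (\<phi> k) * cinner (\<phi> k) g) sums cinner (bessel_operator \<phi> f) g"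
  using bounded_linear.sums[OF bounded_linear_cinner_left bessel_operator_sums[OF assms], of f g]
  by (simp add: cinner_scaleC_left)

lemma cinner_bessel_operator_self:
  fixes \<phi> :: "nat \<Rightarrow> 'h::complex_hilbert"
  assumes "bessel_bound B \<phi>"
  shows "cinner (bessel_operator \<phi> f) f = complex_of_real (\<Sum>k. (cmod (cinner f (\<phi> k)))\<^sup>2)"
proof -
  have "(\<lambda>k. complex_of_real ((cmod (cinner f (\<phi> k)))\<^sup>2)) sums
      complex_of_real (\<Sum>k. (cmod (cinner f (\<phi> k)))\<^sup>2)"
    using assms by (intro sums_of_real summable_sums) (simp add: bessel_bound_def)
  moreover have "complex_of_real ((cmod (cinner f (\<phi> k)))\<^sup>2) = cinner f (\<phi> k) * cinner (\<phi> k) f" for k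
    by (simp only: complex_norm_square cinner_commute[of "\<phi> k" f])
  ultimately show ?thesis
    using cinner_bessel_operator_sums[OF assms, of f f] by (simp add: sums_unique2)
qed

lemma bounded_clinear_bessel_operator:
  fixes \<phi> :: "nat \<Rightarrow> 'h::complex_hilbert"
  assumes bb: "bessel_bound B \<phi>"
  shows "bounded_clinear (bessel_operator \<phi>)"
proof -
  note S = bessel_operator_sums[OF bb]
  have add: "bessel_operator \<phi> (f + g) = bessel_operator \<phi> f + bessel_operator \<phi> g" for f g
    using sums_add[OF S S, of f g] S[of "f + g"]
    by (simp add: cinner_add_left scaleC_add_left sums_unique2)
  have bl: "bounded_linear (\<lambda>x::'h. c *\<^sub>C x)" for c
    by (rule bounded_linear_intro[where K = "cmod c"])
      (auto simp: scaleC_add_right norm_scaleC scaleR_scaleC scaleC_scaleC mult.commute)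
  have sc: "bessel_operator \<phi> (c *\<^sub>C f) = c *\<^sub>C bessel_operator \<phi> f" for c f
    using bounded_linear.sums[OF bl S, of c f] S[of "c *\<^sub>C f"]
    by (simp add: cinner_scaleC_left scaleC_scaleC sums_unique2)
  have bound: "norm (bessel_operator \<phi> f) \<le> norm f * B" for f
  proof (rule LIMSEQ_le_const2[OF tendsto_norm[OF S[unfolded sums_def]]], intro exI allI impI)
    fix n
    have B: "0 < B" using bb by (simp add: bessel_bound_def)
    have "(norm (\<Sum>k<n. cinner f (\<phi> k) *\<^sub>C \<phi> k))\<^sup>2 \<le> B * (\<Sum>k<n. (cmod (cinner f (\<phi> k)))\<^sup>2)"
      by (rule bessel_synthesis_norm_le[OF bb]) simp
    also have "\<dots> \<le> B * (B * (norm f)\<^sup>2)"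
      using B by (intro mult_left_mono bessel_bound_sum_le[OF bb]) auto
    also have "\<dots> = (norm f * B)\<^sup>2"
      by (simp add: power2_eq_square)
    finally show "norm (\<Sum>k<n. cinner f (\<phi> k) *\<^sub>C \<phi> k) \<le> norm f * B"
      using B by (auto intro: power2_le_imp_le)
  qed
  have "bounded_linear (bessel_operator \<phi>)"
    by (rule bounded_linear_intro[where K = B]) (simp_all add: add sc bound scaleR_scaleC)
  then show ?thesis by (simp add: bounded_clinear_def sc)
qed

lemma self_adjoint_bessel_operator:
  fixes \<phi> :: "nat \<Rightarrow> 'h::complex_hilbert"
  assumes "bessel_bound B \<phi>"
  shows "self_adjoint (bessel_operator \<phi>)"
  using assms
  by (intro self_adjoint_if_real_quadratic_form bounded_clinear_bessel_operator)
    (auto simp: cinner_bessel_operator_self)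

lemma positive_semidefinite_bessel_operator:
  fixes \<phi> :: "nat \<Rightarrow> 'h::complex_hilbert"
  assumes "bessel_bound B \<phi>"
  shows "positive_semidefinite (bessel_operator \<phi>)"
  using assms
  by (auto simp: positive_semidefinite_def cinner_bessel_operator_self[OF assms] bessel_bound_def
      intro!: suminf_nonneg)

section \<open>Controlled frames\<close>

text \<open>Padding a family by zero vectors instead of padding the series by zero terms gives the
  same series, since every kind of term vanishes at the zero vector.\<close>

definition enum_vectors ::
    "'i set \<Rightarrow> (nat \<Rightarrow> 'i) \<Rightarrow> ('i \<Rightarrow> 'h::complex_inner) \<Rightarrow> nat \<Rightarrow> 'h"
  where "enum_vectors \<Gamma> e \<psi> = enum_terms \<Gamma> e \<psi>"

lemma enum_terms_enum_vectors:
  assumes "F 0 = 0"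
  shows "enum_terms \<Gamma> e (\<lambda>n. F (\<psi> n)) = (\<lambda>k. F (enum_vectors \<Gamma> e \<psi> k))"
  using assms by (auto simp: enum_vectors_def enum_terms_def)

text \<open>The controlled quadratic form is that of \<open>L C\<close>: since \<open>C\<close> is self-adjoint it can be moved
  off the frame vectors.  So convergence of the controlled series on the diagonal yields, by
  polarization, convergence of \<open>\<Sum>k. \<langle>C f, \<phi>\<^sub>k\<rangle> \<langle>\<phi>\<^sub>k, g\<rangle>\<close> for all \<open>f\<close>, \<open>g\<close>, with a bound.  As \<open>C\<close> is onto, \<open>f\<close> can
  be chosen with \<open>C f = g\<close>, and the terms become the nonnegative numbers \<open>\<bar>\<langle>g, \<phi>\<^sub>k\<rangle>\<bar>\<^sup>2\<close>.\<close>

lemma bessel_bound_if_controlled: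
  fixes C S :: "'h::complex_hilbert \<Rightarrow> 'h" and \<phi> :: "nat \<Rightarrow> 'h"
  assumes C: "bounded_clinear C" and sa: "self_adjoint C"
    and S: "bounded_linear S" "\<And>f. C (S f) = f"
    and M: "0 \<le> M"
    and q: "\<And>f. (\<lambda>k. cinner (\<phi> k) f * cinner f (C (\<phi> k))) sums complex_of_real (s f)"
    and s: "\<And>f. \<bar>s f\<bar> \<le> M * (norm f)\<^sup>2"
  obtains B where "bessel_bound B \<phi>"
proof -
  interpret C: bounded_linear C using C by (simp add: bounded_clinear_def)
  have Csc: "C (c *\<^sub>C x) = c *\<^sub>C C x" for c x
    using C by (simp add: bounded_clinear_def)
  have Cadj: "cinner f (C g) = cinner (C f) g" for f g
    using sa by (simp add: self_adjoint_def)
  \<comment> \<open>Four times the polarized form.\<close>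
  define p where "p f g = complex_of_real (s (f + g)) - complex_of_real (s (f - g))
    + \<i> * complex_of_real (s (f + \<i> *\<^sub>C g)) - \<i> * complex_of_real (s (f - \<i> *\<^sub>C g))" for f g
  have p_sums: "(\<lambda>k. 4 * (cinner (C f) (\<phi> k) * cinner (\<phi> k) g)) sums p f g" for f g
  proof -
    let ?q = "\<lambda>f k. cinner (\<phi> k) f * cinner f (C (\<phi> k))"
    have "(\<lambda>k. ?q (f + g) k - ?q (f - g) k + \<i> * ?q (f + \<i> *\<^sub>C g) k - \<i> * ?q (f - \<i> *\<^sub>C g) k)
        sums p f g"
      unfolding p_def by (intro sums_add sums_diff sums_mult q)
    moreover have "?q (f + g) k - ?q (f - g) k + \<i> * ?q (f + \<i> *\<^sub>C g) k - \<i> * ?q (f - \<i> *\<^sub>C g) k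
        = 4 * (cinner (C f) (\<phi> k) * cinner (\<phi> k) g)" for k
      by (simp add: Cadj C.add C.diff Csc cinner_simps) (simp add: algebra_simps)
    ultimately show ?thesis by simp
  qed
  \<comment> \<open>The bound need not be homogeneous in \<open>f\<close> and \<open>g\<close>: it is used for \<open>f = S g\<close>, whose norm is at most a multiple of \<open>\<parallel>g\<parallel>\<close>.\<close>
  have p_bound: "cmod (p f g) \<le> 4 * (M * (norm f + norm g)\<^sup>2)" for f g
  proof -
    have *: "\<bar>s h\<bar> \<le> M * (norm f + norm g)\<^sup>2" if "norm h \<le> norm f + norm g" for h
      using s[of h] that M by (meson mult_left_mono norm_ge_zero order_trans power_mono)
    have "cmod (p f g) \<le> cmod (complex_of_real (s (f + g))) + cmod (complex_of_real (s (f - g)))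
        + cmod (\<i> * complex_of_real (s (f + \<i> *\<^sub>C g)))
        + cmod (\<i> * complex_of_real (s (f - \<i> *\<^sub>C g)))"
      unfolding p_def
      by (intro norm_triangle_le_diff norm_triangle_le add_mono order_refl)
    also have "\<dots> = \<bar>s (f + g)\<bar> + \<bar>s (f - g)\<bar> + \<bar>s (f + \<i> *\<^sub>C g)\<bar> + \<bar>s (f - \<i> *\<^sub>C g)\<bar>"
      by (simp add: norm_mult)
    also have "\<dots> \<le> M * (norm f + norm g)\<^sup>2 + M * (norm f + norm g)\<^sup>2
        + M * (norm f + norm g)\<^sup>2 + M * (norm f + norm g)\<^sup>2"
      using norm_triangle_ineq[of f "\<i> *\<^sub>C g"] norm_triangle_ineq4[of f "\<i> *\<^sub>C g"]
      by (intro add_mono *) (auto simp: norm_scaleC norm_triangle_ineq norm_triangle_ineq4)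
    finally show ?thesis by simp
  qed
  obtain K where K: "0 < K" "\<And>f. norm (S f) \<le> norm f * K"
    using bounded_linear.pos_bounded[OF S(1)] by auto
  define B where "B = M * (K + 1)\<^sup>2 + 1"
  have "bessel_bound B \<phi>"
    unfolding bessel_bound_def
  proof (intro conjI allI)
    show "0 < B" using M by (auto simp: B_def intro: add_nonneg_pos)
  next
    fix g
    have terms: "cinner (C (S g)) (\<phi> k) * cinner (\<phi> k) g
        = complex_of_real ((cmod (cinner g (\<phi> k)))\<^sup>2)" for k
      by (simp only: S complex_norm_square cinner_commute[of "\<phi> k" g])
    have "(\<lambda>k. Re (4 * complex_of_real ((cmod (cinner g (\<phi> k)))\<^sup>2))) sums Re (p (S g) g)"
      using p_sums[of "S g" g] by (intro sums_Re) (simp only: terms)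
    then have "(\<lambda>k. 4 * (cmod (cinner g (\<phi> k)))\<^sup>2 / 4) sums (Re (p (S g) g) / 4)"
      by (intro sums_divide) simp
    then have sum: "(\<lambda>k. (cmod (cinner g (\<phi> k)))\<^sup>2) sums (Re (p (S g) g) / 4)"
      by simp
    then show "summable (\<lambda>k. (cmod (cinner g (\<phi> k)))\<^sup>2)"
      by (rule sums_summable)
    have "Re (p (S g) g) / 4 \<le> M * (norm (S g) + norm g)\<^sup>2"
      using p_bound[of "S g" g] complex_Re_le_cmod[of "p (S g) g"] by linarith
    also have "\<dots> \<le> M * (norm g * K + norm g)\<^sup>2"
      by (intro mult_left_mono power_mono add_mono K M) auto
    also have "\<dots> = (M * (K + 1)\<^sup>2) * (norm g)\<^sup>2"
      by (simp add: power2_eq_square algebra_simps)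
    also have "\<dots> \<le> B * (norm g)\<^sup>2"
      by (intro mult_right_mono) (auto simp: B_def)
    finally show "(\<Sum>k. (cmod (cinner g (\<phi> k)))\<^sup>2) \<le> B * (norm g)\<^sup>2"
      using sum by (simp add: sums_iff)
  qed
  then show ?thesis by (rule that)
qed

lemma GL_bounded_below:
  fixes C :: "'h::complex_inner \<Rightarrow> 'h"
  assumes "C \<in> GL"
  obtains a where "0 < a" "\<And>f. a * norm f \<le> norm (C f)"
proof -
  obtain S where S: "bounded_linear S" "\<And>f. S (C f) = f"
    using assms by (auto simp: GL_def bounded_clinear_def fun_eq_iff)
  obtain K where "0 < K" "\<And>f. norm (S f) \<le> norm f * K"
    using bounded_linear.pos_bounded[OF S(1)] by auto
  then show ?thesis
    using S(2) by (intro that[of "1 / K"]) (auto simp: field_simps, metis)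
qed

text \<open>A coercive self-adjoint \<open>L C\<close> forces \<open>C \<ge> 0\<close>: the operators \<open>L C\<close> and \<open>L\<close> are positive and
  commute, so \<open>\<langle>C L f, L f\<rangle> \<ge> 0\<close> for all \<open>f\<close>, and the range of \<open>L\<close> is dense.\<close>

lemma positive_semidefinite_factor:
  fixes C L :: "'h::complex_inner \<Rightarrow> 'h"
  assumes C: "bounded_linear C" and saC: "self_adjoint C"
    and L: "bounded_linear L" and saL: "self_adjoint L" and posL: "positive_semidefinite L"
    and coerL: "0 < c" "\<And>f. c * (norm f)\<^sup>2 \<le> Re (cinner (L f) f)"
    and comm: "\<And>f. C (L f) = L (C f)"
    and posLC: "positive_semidefinite (\<lambda>f. L (C f))"
  shows "positive_semidefinite C"
proof -
  interpret C: bounded_linear C by (rule C)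
  have "positive_semidefinite (\<lambda>f. L (C (L f)))"
    by (rule positive_semidefinite_commuting_product[OF L saL posL _ posLC])
      (auto intro: bounded_linear_compose[OF L C] simp: comm)
  then have range: "0 \<le> Re (cinner (C (L g)) (L g))" for g
    using saL by (simp add: positive_semidefinite_def self_adjoint_def)
  have "0 \<le> Re (cinner (C f) f)" for f
  proof -
    obtain g where g: "(\<lambda>n. L (g n)) \<longlonglongrightarrow> f"
      using coercive_dense_range[OF L saL coerL] by blast
    have "(\<lambda>n. Re (cinner (C (L (g n))) (L (g n)))) \<longlonglongrightarrow> Re (cinner (C f) f)"
      by (intro tendsto_Re bounded_bilinear.tendsto[OF bounded_bilinear_cinner] C.tendsto g)
    then show ?thesis
      by (rule LIMSEQ_le_const) (use range in auto)
  qed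
  then show ?thesis by (simp add: positive_semidefinite_def)
qed

theorem proposition3p3:
  fixes C :: "'h::complex_hilbert \<Rightarrow> 'h"
    and \<Gamma> :: "'i set" and e :: "nat \<Rightarrow> 'i" and \<psi> :: "'i \<Rightarrow> 'h"
  assumes "separable_space (euclidean :: 'h topology)"
    and "C \<in> GL" and "self_adjoint C"
    and "countable \<Gamma>" and "enumeration \<Gamma> e"
  shows "controlled_frame C \<Gamma> e \<psi> \<longleftrightarrow>
         is_frame \<Gamma> e \<psi> \<and> positive_op C \<and>
         C \<circ> frame_operator \<Gamma> e \<psi> = frame_operator \<Gamma> e \<psi> \<circ> C"
proof -
  obtain S where C: "bounded_clinear C" and S: "bounded_linear S" "\<And>f. C (S f) = f"
    using assms(2) by (auto simp: GL_def bounded_clinear_def fun_eq_iff)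
  have saC: "self_adjoint C" by fact
  have linC: "bounded_linear C" and Csc: "\<And>c x. C (c *\<^sub>C x) = c *\<^sub>C C x"
    using C by (auto simp: bounded_clinear_def)
  interpret C: bounded_linear C by (rule linC)
  obtain a where a: "0 < a" "\<And>f. a * norm f \<le> norm (C f)"
    using GL_bounded_below[OF assms(2)] by blast
  define \<phi> where "\<phi> = enum_vectors \<Gamma> e \<psi>"
  define L where "L = bessel_operator \<phi>"
  have terms_sq: "enum_terms \<Gamma> e (\<lambda>n. (cmod (cinner f (\<psi> n)))\<^sup>2)
      = (\<lambda>k. (cmod (cinner f (\<phi> k)))\<^sup>2)" for f
    unfolding \<phi>_def by (rule enum_terms_enum_vectors) simp
  have terms_C: "enum_terms \<Gamma> e (\<lambda>n. cinner (\<psi> n) f * cinner f (C (\<psi> n)))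
      = (\<lambda>k. cinner (\<phi> k) f * cinner f (C (\<phi> k)))" for f
    unfolding \<phi>_def by (rule enum_terms_enum_vectors) simp
  have L_eq: "frame_operator \<Gamma> e \<psi> = L"
  proof
    fix f
    have "enum_terms \<Gamma> e (\<lambda>n. cinner f (\<psi> n) *\<^sub>C \<psi> n) = (\<lambda>k. cinner f (\<phi> k) *\<^sub>C \<phi> k)"
      unfolding \<phi>_def by (rule enum_terms_enum_vectors) simp
    then show "frame_operator \<Gamma> e \<psi> f = L f"
      by (simp add: frame_operator_def L_def bessel_operator_def)
  qed
  have form: "(\<lambda>k. cinner (\<phi> k) f * cinner f (C (\<phi> k))) sums cinner (L (C f)) f"
    if "bessel_bound B \<phi>" for B f
    using cinner_bessel_operator_sums[OF that, of "C f" f] saC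
    by (simp add: L_def self_adjoint_def mult.commute)
  show ?thesis
  proof (intro iffI conjI)
    assume "controlled_frame C \<Gamma> e \<psi>"
    then obtain m M where m: "0 < m"
      and ex: "\<forall>f. \<exists>s. (\<lambda>k. cinner (\<phi> k) f * cinner f (C (\<phi> k))) sums complex_of_real s \<and>
          m * (norm f)\<^sup>2 \<le> s \<and> s \<le> M * (norm f)\<^sup>2"
      unfolding controlled_frame_def terms_C by blast
    from choice[OF ex] obtain s where s_sums: "\<And>f. (\<lambda>k. cinner (\<phi> k) f * cinner f (C (\<phi> k))) sums complex_of_real (s f)"
      and s_ge: "\<And>f. m * (norm f)\<^sup>2 \<le> s f" and s_le: "\<And>f. s f \<le> M * (norm f)\<^sup>2"
      by blast
    have "\<bar>s f\<bar> \<le> \<bar>M\<bar> * (norm f)\<^sup>2" for f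
    proof -
      have "0 \<le> m * (norm f)\<^sup>2" using m by simp
      then have "\<bar>s f\<bar> \<le> M * (norm f)\<^sup>2" using s_ge[of f] s_le[of f] by linarith
      also have "\<dots> \<le> \<bar>M\<bar> * (norm f)\<^sup>2" by (intro mult_right_mono) auto
      finally show ?thesis .
    qed
    then obtain B where bb: "bessel_bound B \<phi>"
      using bessel_bound_if_controlled[OF C saC S abs_ge_zero s_sums] by blast
    have clinL: "bounded_clinear L" and saL: "self_adjoint L" and posL: "positive_semidefinite L"
      using bb unfolding L_def
      by (auto intro: bounded_clinear_bessel_operator self_adjoint_bessel_operator
          positive_semidefinite_bessel_operator)
    have linL: "bounded_linear L" and Lsc: "\<And>c x. L (c *\<^sub>C x) = c *\<^sub>C L x"
      using clinL by (auto simp: bounded_clinear_def)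
    have LC_form: "cinner (L (C f)) f = complex_of_real (s f)" for f
      using form[OF bb] s_sums by (rule sums_unique2)
    have "self_adjoint (\<lambda>f. L (C f))"
      by (rule self_adjoint_if_real_quadratic_form)
        (auto simp: bounded_clinear_def Csc Lsc LC_form intro: bounded_linear_compose[OF linL linC])
    \<comment> \<open>A product of two self-adjoint operators is self-adjoint only if they commute.\<close>
    then have "cinner (C (L f) - L (C f)) g = 0" for f g
      using saL saC by (simp add: self_adjoint_def cinner_diff_left)
    then have comm: "C (L f) = L (C f)" for f
      using Re_cinner_self[of "C (L f) - L (C f)"] by (simp del: Re_cinner_self)
    then show "C \<circ> frame_operator \<Gamma> e \<psi> = frame_operator \<Gamma> e \<psi> \<circ> C"
      by (auto simp: L_eq)
    obtain K where K: "0 < K" "\<And>f. norm (C f) \<le> K * norm f"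
      using bounded_linear_quadratic_form_bound[OF linC] by metis
    \<comment> \<open>\<open>L f = (L C) (S f)\<close>, where \<open>L C\<close> is bounded below and \<open>\<parallel>f\<parallel> \<le> K \<parallel>S f\<parallel>\<close>.\<close>
    have below: "m / K * norm f \<le> norm (L f)" for f
    proof (cases "S f = 0")
      case True
      then have "f = 0" using S(2)[of f] by (simp add: C.zero)
      then show ?thesis by simp
    next
      case False
      have "m * (norm (S f))\<^sup>2 \<le> Re (cinner (L (C (S f))) (S f))"
        using s_ge by (simp add: LC_form)
      also have "\<dots> \<le> norm (L (C (S f))) * norm (S f)"
        by (rule Re_cinner_le_norm)
      finally have "m * norm (S f) \<le> norm (L f)"
        using False by (simp add: S power2_eq_square)
      moreover have "norm f \<le> K * norm (S f)"
        using K(2)[of "S f"] by (simp add: S)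
      then have "m * norm f \<le> m * (K * norm (S f))"
        using m by simp
      ultimately have "m * norm f \<le> K * norm (L f)"
        using K(1) by (smt (verit) mult.left_commute mult_left_mono)
      then show ?thesis using K(1) by (simp add: field_simps)
    qed
    obtain c where c: "0 < c" "\<And>f. c * (norm f)\<^sup>2 \<le> Re (cinner (L f) f)"
      using positive_semidefinite_coercive[OF linL saL posL _ below] m K(1) by auto
    show "is_frame \<Gamma> e \<psi>"
      unfolding is_frame_def terms_sq
      using c bb by (intro exI[of _ c] exI[of _ B])
        (auto simp: L_def cinner_bessel_operator_self[OF bb] bessel_bound_def)
    have "positive_semidefinite (\<lambda>f. L (C f))"
      unfolding positive_semidefinite_def LC_form
      using s_ge m by (smt (verit) Re_complex_of_real mult_nonneg_nonneg zero_le_power2)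
    then have "positive_semidefinite C"
      by (rule positive_semidefinite_factor[OF linC saC linL saL posL c comm])
    then obtain b where b: "0 < b" "\<And>f. b * (norm f)\<^sup>2 \<le> Re (cinner (C f) f)"
      using positive_semidefinite_coercive[OF linC saC _ a] by blast
    show "positive_op C"
      unfolding positive_op_def
    proof (intro allI impI conjI)
      fix f :: 'h assume "f \<noteq> 0"
      then have "0 < b * (norm f)\<^sup>2" using b(1) by simp
      then show "0 < Re (cinner (C f) f)" using b(2)[of f] by linarith
      have "cinner (C f) f = cnj (cinner (C f) f)"
        using saC cinner_commute[of "C f" f] by (simp add: self_adjoint_def)
      then show "cinner (C f) f \<in> \<real>" by (simp add: complex_is_Real_iff complex_eq_iff)
    qed
  next
    assume asm: "is_frame \<Gamma> e \<psi> \<and> positive_op C \<and>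
         C \<circ> frame_operator \<Gamma> e \<psi> = frame_operator \<Gamma> e \<psi> \<circ> C"
    then have comm: "C (L f) = L (C f)" for f
      by (simp add: L_eq fun_eq_iff)
    obtain m M where m: "0 < m"
      and summ: "\<And>f. summable (\<lambda>k. (cmod (cinner f (\<phi> k)))\<^sup>2)"
      and ge: "\<And>f. m * (norm f)\<^sup>2 \<le> (\<Sum>k. (cmod (cinner f (\<phi> k)))\<^sup>2)"
      and le: "\<And>f. (\<Sum>k. (cmod (cinner f (\<phi> k)))\<^sup>2) \<le> M * (norm f)\<^sup>2"
      using asm unfolding is_frame_def terms_sq by blast
    \<comment> \<open>A frame for the zero space may have \<open>M \<le> 0\<close>, whereas Bessel bounds are positive.\<close>
    have "M * (norm f)\<^sup>2 \<le> (\<bar>M\<bar> + 1) * (norm f)\<^sup>2" for f :: 'h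
      by (intro mult_right_mono) auto
    then have bb: "bessel_bound (\<bar>M\<bar> + 1) \<phi>"
      unfolding bessel_bound_def using summ le by (auto intro: order_trans)
    have clinL: "bounded_clinear L" and saL: "self_adjoint L"
      using bb unfolding L_def
      by (auto intro: bounded_clinear_bessel_operator self_adjoint_bessel_operator)
    have linL: "bounded_linear L"
      using clinL by (auto simp: bounded_clinear_def)
    have "0 \<le> Re (cinner (C f) f)" for f
      using asm by (cases "f = 0") (auto simp: positive_op_def less_imp_le)
    then have posC: "positive_semidefinite C"
      by (simp add: positive_semidefinite_def)
    obtain b where b: "0 < b" "\<And>f. b * (norm f)\<^sup>2 \<le> Re (cinner (C f) f)"
      using positive_semidefinite_coercive[OF linC saC posC a] by blast
    have "positive_semidefinite (\<lambda>f. L f - m *\<^sub>R f)"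
      using ge by (simp add: positive_semidefinite_def cinner_simps L_def
          cinner_bessel_operator_self[OF bb])
    then have "positive_semidefinite (\<lambda>f. L (C f) - m *\<^sub>R C f)"
      by (intro positive_semidefinite_commuting_product[OF linC saC posC])
        (auto simp: C.diff C.scale comm intro: bounded_linear_sub linL bounded_linear_scaleR_right)
    then have shifted: "m * Re (cinner (C f) f) \<le> Re (cinner (L (C f)) f)" for f
      by (simp add: positive_semidefinite_def cinner_simps)
    obtain K where K: "\<And>f. Re (cinner (L (C f)) f) \<le> K * (norm f)\<^sup>2"
      using bounded_linear_quadratic_form_bound[OF bounded_linear_compose[OF linL linC]] by metis
    have real: "complex_of_real (Re (cinner (L (C f)) f)) = cinner (L (C f)) f" for f
    proof -
      have "cinner (L (C f)) f = cinner f (L (C f))"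
        using saL saC comm by (simp add: self_adjoint_def)
      then have "cinner (L (C f)) f = cnj (cinner (L (C f)) f)"
        by (metis cinner_commute)
      then show ?thesis by (simp add: complex_eq_iff)
    qed
    show "controlled_frame C \<Gamma> e \<psi>"
      unfolding controlled_frame_def terms_C
    proof (intro exI conjI allI)
      show "0 < m * b" using m b(1) by simp
    next
      fix f
      show "(\<lambda>k. cinner (\<phi> k) f * cinner f (C (\<phi> k))) sums
          complex_of_real (Re (cinner (L (C f)) f))"
        using form[OF bb] by (simp add: real)
      show "Re (cinner (L (C f)) f) \<le> K * (norm f)\<^sup>2" by (rule K)
      have "m * b * (norm f)\<^sup>2 \<le> m * Re (cinner (C f) f)"
        using b(2)[of f] m by (simp add: mult.assoc)
      then show "m * b * (norm f)\<^sup>2 \<le> Re (cinner (L (C f)) f)"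
        using shifted[of f] by linarith
    qed
  qed
qed

end
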